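(* Let $\mathcal{H}$ be a complex separable Hilbert space, $W$ a bounded selfadjoint operator on $\mathcal{H}$, and $\mathcal{S}$ a (not necessarily closed) subspace of $\mathcal{H}$. The following are equivalent: (i) $W$ is $\mathcal{S}$-complementable; (ii) $WP_{W,\mathcal{S}}=P_{W,\mathcal{S}}^*W$ and $\operatorname{ran}W\subseteq\operatorname{dom}P_{W,\mathcal{S}}^*$; (iii) there exists a $W$-selfadjoint multivalued projection $Q$ in $\mathcal{H}$ with $\operatorname{ran}Q=\mathcal{S}$ and $\operatorname{dom}Q=\mathcal{H}$.
   Context: A linear relation in $\mathcal{H}$ is a linear subspace $T$ of $\mathcal{H}\times\mathcal{H}$; operators are identified with their graphs. $\operatorname{dom}T$, $\operatorname{ran}T$ are the domain and range, $RT=\{(x,y): (x,z)\in T,\ (z,y)\in R\text{ for some }z\}$, and $T^*=\{(x,y):\langle g,x\rangle=\langle f,y\rangle\text{ for all }(f,g)\in T\}$. A multivalued projection is a linear relation $Q$ with $Q^2=Q$ and $\operatorname{ran}Q\subseteq\operatorname{dom}Q$; equivalently $Q=P_{\mathcal{M},\mathcal{N}}:=\{(m+n,m):m\in\mathcal{M},n\in\mathcal{N}\}$ with $\mathcal{M}=\operatorname{ran}Q$, $\mathcal{N}=\ker Q$ (not necessarily closed). $Q$ is $W$-selfadjoint if $WQ=(WQ)^*$; since $W$ is bounded and selfadjoint this means $WQ=Q^*W$. $P_{W,\mathcal{S}}:=P_{\mathcal{S},(W\mathcal{S})^\perp}$, where $(W\mathcal{S})^\perp=\{x:\langle Wx,s\rangle=0\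 \forall s\in\mathcal{S}\}$. $W$ is $\mathcal{S}$-complementable if $\operatorname{dom}P_{W,\mathcal{S}}=\mathcal{H}$, i.e. $\mathcal{S}+(W\mathcal{S})^\perp=\mathcal{H}$. *)

theory Defs
  imports "HOL-Analysis.Analysis"
begin

section \<open>Complex Hilbert spaces\<close>

class complex_vector = real_vector +
  fixes scaleC :: "complex \<Rightarrow> 'a \<Rightarrow> 'a" (infixr \<open>*\<^sub>C\<close> 75)
  assumes scaleC_add_right: "c *\<^sub>C (x + y) = c *\<^sub>C x + c *\<^sub>C y"
    and scaleC_add_left: "(c + d) *\<^sub>C x = c *\<^sub>C x + d *\<^sub>C x"
    and scaleC_scaleC: "c *\<^sub>C d *\<^sub>C x = (c * d) *\<^sub>C x"
    and scaleC_one: "1 *\<^sub>C x = x"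
    and scaleR_scaleC: "scaleR r x = complex_of_real r *\<^sub>C x"

global_interpretation complex_vector:
  vector_space "scaleC :: complex \<Rightarrow> 'a \<Rightarrow> 'a::complex_vector"
  defines csubspace = complex_vector.subspace
  by unfold_locales (simp_all add: scaleC_add_right scaleC_add_left scaleC_scaleC scaleC_one)

text \<open>The inner product is linear in its first argument.  Every complex Hilbert space is
  an instance, since its norm and its real scalar multiplication are determined by the
  complex structure.\<close>

class complex_inner = complex_vector + real_normed_vector +
  fixes cinner :: "'a \<Rightarrow> 'a \<Rightarrow> complex"
  assumes cinner_commute: "cinner x y = cnj (cinner y x)"
    and cinner_add_left: "cinner (x + y) z = cinner x z + cinner y z"
    and cinner_scaleC_left: "cinner (c *\<^sub>C x) y = c * cinner x y"
    and cinner_self: "cinner x x = complex_of_real ((norm x)\<^sup>2)"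

class complex_hilbert_space = complex_inner + complete_space

instantiation complex :: complex_hilbert_space
begin

definition scaleC_complex :: "complex \<Rightarrow> complex \<Rightarrow> complex"
  where "scaleC_complex c x = c * x"

definition cinner_complex :: "complex \<Rightarrow> complex \<Rightarrow> complex"
  where "cinner_complex x y = x * cnj y"

instance
proof
  show "cinner x x = complex_of_real ((norm x)\<^sup>2)" for x :: complex
    by (simp only: cinner_complex_def complex_norm_square)
qed (simp_all add: scaleC_complex_def cinner_complex_def distrib_left distrib_right
    scaleR_conv_of_real)

end

text \<open>The algebraic structure of \<open>H \<times> H\<close>, which makes \<open>csubspace\<close> applicable to relations.\<close>

instantiation prod :: (complex_vector, complex_vector) complex_vector
begin

definition scaleC_prod :: "complex \<Rightarrow> 'a \<times> 'b \<Rightarrow> 'a \<times> 'b"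
  where "scaleC_prod c p = (c *\<^sub>C fst p, c *\<^sub>C snd p)"

instance
  by standard
    (simp_all add: scaleC_prod_def prod_eq_iff scaleC_add_right scaleC_add_left scaleC_scaleC
      scaleC_one scaleR_scaleC)

end

definition bounded_clinear :: "('a::complex_inner \<Rightarrow> 'b::complex_inner) \<Rightarrow> bool"
  where "bounded_clinear W \<longleftrightarrow>
    Vector_Spaces.linear scaleC scaleC W \<and> (\<exists>K. \<forall>x. norm (W x) \<le> norm x * K)"


section \<open>Linear relations\<close>

definition linear_relation :: "('a::complex_inner \<times> 'a) set \<Rightarrow> bool"
  where "linear_relation T \<longleftrightarrow> csubspace T"

definition op_graph :: "('a \<Rightarrow> 'a) \<Rightarrow> ('a \<times> 'a) set"
  where "op_graph W = {(x, y). y = W x}"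

text \<open>The product \<open>RT\<close> applies \<open>T\<close> first, whereas \<open>T O R\<close> lists the factors in the
  order of application.\<close>

definition rel_prod :: "('a \<times> 'a) set \<Rightarrow> ('a \<times> 'a) set \<Rightarrow> ('a \<times> 'a) set" (infixr \<open>\<odot>\<close> 75)
  where "R \<odot> T = T O R"

definition rel_adjoint :: "('a::complex_inner \<times> 'a) set \<Rightarrow> ('a \<times> 'a) set"
  where "rel_adjoint T = {(x, y). \<forall>(f, g) \<in> T. cinner g x = cinner f y}"

definition selfadjoint_relation :: "('a::complex_inner \<times> 'a) set \<Rightarrow> bool"
  where "selfadjoint_relation T \<longleftrightarrow> T = rel_adjoint T"

definition multivalued_projection :: "('a::complex_inner \<times> 'a) set \<Rightarrow> bool"
  where "multivalued_projection Q \<longleftrightarrow>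
    linear_relation Q \<and> Q \<odot> Q = Q \<and> Range Q \<subseteq> Domain Q"

definition proj_rel :: "'a::complex_inner set \<Rightarrow> 'a set \<Rightarrow> ('a \<times> 'a) set"
  where "proj_rel M N = {(m + n, m) | m n. m \<in> M \<and> n \<in> N}"

text \<open>For selfadjoint \<open>W\<close> this is the orthogonal complement of \<open>W ` S\<close>; see
  \<open>W_orth_eq_orthogonal_complement\<close>.\<close>

definition W_orth :: "('a::complex_inner \<Rightarrow> 'a) \<Rightarrow> 'a set \<Rightarrow> 'a set"
  where "W_orth W S = {x. \<forall>s \<in> S. cinner (W x) s = 0}"

lemma W_orth_eq_orthogonal_complement:
  assumes "selfadjoint_relation (op_graph W)"
  shows "W_orth W S = {x. \<forall>y \<in> W ` S. cinner x y = 0}"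
proof -
  have "cinner (W x) s = cinner x (W s)" for x s
  proof -
    have "(s, W s) \<in> rel_adjoint (op_graph W)"
      using assms by (auto simp: selfadjoint_relation_def op_graph_def)
    then show ?thesis
      by (auto simp: rel_adjoint_def op_graph_def)
  qed
  then show ?thesis
    by (simp add: W_orth_def)
qed

definition W_proj :: "('a::complex_inner \<Rightarrow> 'a) \<Rightarrow> 'a set \<Rightarrow> ('a \<times> 'a) set"
  where "W_proj W S = proj_rel S (W_orth W S)"

definition complementable :: "('a::complex_inner \<Rightarrow> 'a) \<Rightarrow> 'a set \<Rightarrow> bool"
  where "complementable W S \<longleftrightarrow> Domain (W_proj W S) = UNIV"

definition W_selfadjoint :: "('a::complex_inner \<Rightarrow> 'a) \<Rightarrow> ('a \<times> 'a) set \<Rightarrow> bool"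
  where "W_selfadjoint W Q \<longleftrightarrow> selfadjoint_relation (op_graph W \<odot> Q)"

end

theory Submission
  imports Defs
begin

text \<open>
  Writing \<open>P\<close> for \<open>W_proj W S\<close>, symmetry of \<open>W\<close> gives \<open>WP \<subseteq> P\<^sup>*W = (WP)\<^sup>*\<close>, and the multivalued
  part of \<open>P\<^sup>*W\<close> is orthogonal to the domain of \<open>P\<close>.  Hence all three relations coincide once
  \<open>P\<close> is everywhere defined, so that \<open>P\<close> itself is the required \<open>Q\<close>.  Conversely, if \<open>Q\<close> is a
  \<open>W\<close>-selfadjoint projection onto \<open>S\<close> and \<open>(x, m) \<in> Q\<close>, then \<open>x - m\<close> lies in the kernel of \<open>Q\<close>,
  and selfadjointness of \<open>WQ\<close> makes this kernel orthogonal to \<open>W S\<close>.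
\<close>

section \<open>Inner products and bounded selfadjoint operators\<close>

lemma cinner_add_right: "cinner x (y + z) = cinner x y + cinner x (z::'a::complex_inner)"
  by (metis cinner_commute cinner_add_left complex_cnj_add)

lemma cinner_diff_right: "cinner x (y - z) = cinner x y - cinner x (z::'a::complex_inner)"
  by (metis cinner_add_right add_diff_cancel_right' diff_add_cancel)

lemma cinner_zero_left [simp]: "cinner 0 (x::'a::complex_inner) = 0"
  using cinner_add_left[of 0 0 x] by simp

lemma cinner_zero_right [simp]: "cinner (x::'a::complex_inner) 0 = 0"
  by (metis cinner_commute cinner_zero_left complex_cnj_zero)

lemma cinner_eq_zero_commute: "cinner x y = 0 \<longleftrightarrow> cinner y (x::'a::complex_inner) = 0"
  by (metis cinner_commute complex_cnj_zero)

lemma cinner_self_eq_zero [simp]: "cinner x x = 0 \<longleftrightarrow> x = (0::'a::complex_inner)"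
  by (simp add: cinner_self)

lemma bounded_clinear_add: "bounded_clinear W \<Longrightarrow> W (x + y) = W x + W y"
  unfolding bounded_clinear_def
  by (metis Vector_Spaces.linear_iff)

lemma bounded_clinear_scaleC: "bounded_clinear W \<Longrightarrow> W (c *\<^sub>C x) = c *\<^sub>C W x"
  unfolding bounded_clinear_def
  by (metis Vector_Spaces.linear_iff)

lemma bounded_clinear_zero: "bounded_clinear W \<Longrightarrow> W 0 = 0"
  by (metis add_cancel_right_left add_0 bounded_clinear_add)

lemma selfadjoint_op_graph_cinner:
  assumes "selfadjoint_relation (op_graph W)"
  shows "cinner (W x) y = cinner x (W y)"
proof -
  have "(y, W y) \<in> rel_adjoint (op_graph W)"
    using assms by (auto simp: selfadjoint_relation_def op_graph_def)
  then show ?thesis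
    by (auto simp: rel_adjoint_def op_graph_def)
qed

section \<open>Multivalued projections and adjoints of relations\<close>

lemma csubspace_W_orth:
  assumes "bounded_clinear W"
  shows "csubspace (W_orth W S)"
  unfolding complex_vector.subspace_def W_orth_def
  by (auto simp: bounded_clinear_zero[OF assms] bounded_clinear_add[OF assms]
      bounded_clinear_scaleC[OF assms] cinner_add_left cinner_scaleC_left)

lemma op_graph_rel_prod_proj_rel:
  "op_graph W \<odot> proj_rel M N = {(m + n, W m) | m n. m \<in> M \<and> n \<in> N}"
  by (auto simp: rel_prod_def op_graph_def proj_rel_def)

lemma linear_relation_proj_rel:
  assumes M: "csubspace M" and N: "csubspace N"
  shows "linear_relation (proj_rel M N)"
  unfolding linear_relation_def complex_vector.subspace_def
proof (intro conjI ballI allI)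
  show "0 \<in> proj_rel M N"
    using complex_vector.subspace_0[OF M] complex_vector.subspace_0[OF N]
    by (force simp: proj_rel_def zero_prod_def)
next
  fix p q assume "p \<in> proj_rel M N" "q \<in> proj_rel M N"
  then obtain m n m' n' where pq: "p = (m + n, m)" "q = (m' + n', m')"
    and mem: "m \<in> M" "n \<in> N" "m' \<in> M" "n' \<in> N"
    by (auto simp: proj_rel_def)
  have "p + q = ((m + m') + (n + n'), m + m')"
    by (simp add: pq)
  then show "p + q \<in> proj_rel M N"
    using mem complex_vector.subspace_add[OF M] complex_vector.subspace_add[OF N]
    unfolding proj_rel_def by blast
next
  fix c p assume "p \<in> proj_rel M N"
  then obtain m n where p: "p = (m + n, m)" and mem: "m \<in> M" "n \<in> N"
    by (auto simp: proj_rel_def)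
  have "c *\<^sub>C p = (c *\<^sub>C m + c *\<^sub>C n, c *\<^sub>C m)"
    by (simp add: p scaleC_prod_def scaleC_add_right)
  then show "c *\<^sub>C p \<in> proj_rel M N"
    using mem complex_vector.subspace_scale[OF M] complex_vector.subspace_scale[OF N]
    unfolding proj_rel_def by blast
qed

lemma Range_proj_rel: "0 \<in> N \<Longrightarrow> Range (proj_rel M N) = M"
  by (auto simp: proj_rel_def)

text \<open>As \<open>0 \<in> N\<close>, every element of \<open>M\<close> is related to itself. So
  each pair \<open>(x, y)\<close> factors through \<open>(y, y)\<close>, which yields both
  \<open>Q \<subseteq> Q \<odot> Q\<close> and the inclusion of the range in the domain.\<close>

lemma multivalued_projection_proj_rel:
  assumes M: "csubspace M" and N: "csubspace N"
  shows "multivalued_projection (proj_rel M N)"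
proof -
  have diag: "(m, m) \<in> proj_rel M N" if "m \<in> M" for m
    using that complex_vector.subspace_0[OF N] by (force simp: proj_rel_def)
  have "(x, z) \<in> proj_rel M N"
    if xy: "(x, y) \<in> proj_rel M N" and yz: "(y, z) \<in> proj_rel M N" for x y z
  proof -
    obtain n where n: "x = y + n" "n \<in> N"
      using xy by (auto simp: proj_rel_def)
    obtain n' where n': "y = z + n'" "z \<in> M" "n' \<in> N"
      using yz by (auto simp: proj_rel_def)
    \<comment> \<open>The two components in \<open>N\<close> merge into one, so composing twice
      stays inside the relation.\<close>
    have "x = z + (n' + n)"
      using n(1) n'(1) by (simp add: add.assoc)
    then show ?thesis
      using n(2) n'(2,3) complex_vector.subspace_add[OF N] unfolding proj_rel_def by blast
  qed
  moreover have "(y, y) \<in> proj_rel M N" if "(x, y) \<in> proj_rel M N" for x y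
    using that diag by (auto simp: proj_rel_def)
  ultimately show ?thesis
    using linear_relation_proj_rel[OF M N]
    unfolding multivalued_projection_def rel_prod_def
    by (intro conjI equalityI subrelI; blast)
qed

text \<open>The element \<open>m\<close> has some image \<open>k\<close>, and idempotence makes
  \<open>k\<close> an image of \<open>x\<close> too; subtracting \<open>(m, k)\<close> from
  \<open>(x, k)\<close> leaves a kernel element. This splits the domain into range plus
  kernel.\<close>

lemma multivalued_projection_diff_in_kernel:
  assumes Q: "multivalued_projection Q" and xm: "(x, m) \<in> Q"
  shows "(x - m, 0) \<in> Q"
proof -
  have sub: "csubspace Q" and idem: "Q O Q = Q" and dom: "Range Q \<subseteq> Domain Q"
    using Q by (simp_all add: multivalued_projection_def linear_relation_def rel_prod_def)
  obtain k where mk: "(m, k) \<in> Q"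
    using xm dom by blast
  then have "(x, k) \<in> Q"
    using xm idem by blast
  from complex_vector.subspace_diff[OF sub this mk]
  show ?thesis by simp
qed

text \<open>Moving the everywhere defined, symmetric \<open>W\<close> across the inner product turns
  the condition on \<open>x\<close> into the same condition on \<open>W x\<close>. This links
  selfadjointness of \<open>WQ\<close> with the equation in (ii).\<close>

lemma rel_adjoint_op_graph_rel_prod:
  assumes "selfadjoint_relation (op_graph W)"
  shows "rel_adjoint (op_graph W \<odot> Q) = rel_adjoint Q \<odot> op_graph W"
proof -
  have "(x, y) \<in> rel_adjoint (op_graph W \<odot> Q) \<longleftrightarrow> (W x, y) \<in> rel_adjoint Q" for x y
  proof -
    have "(x, y) \<in> rel_adjoint (op_graph W \<odot> Q) \<longleftrightarrow>
        (\<forall>f g. (f, g) \<in> Q \<longrightarrow> cinner (W g) x = cinner f y)"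
      unfolding rel_adjoint_def rel_prod_def op_graph_def by blast
    then show ?thesis
      by (auto simp: rel_adjoint_def selfadjoint_op_graph_cinner[OF assms])
  qed
  then show ?thesis
    by (auto simp: rel_prod_def op_graph_def)
qed

lemma op_graph_W_proj_subset:
  assumes bdd: "bounded_clinear W" and sa: "selfadjoint_relation (op_graph W)"
  shows "op_graph W \<odot> W_proj W S \<subseteq> rel_adjoint (W_proj W S) \<odot> op_graph W"
proof -
  \<comment> \<open>The cross terms of \<open>S\<close> with \<open>W_orth W S\<close> vanish, so
    both sides reduce to \<open>cinner m (W m')\<close>.\<close>
  have "cinner m (W (m' + n')) = cinner (m + n) (W m')"
    if "m \<in> S" "m' \<in> S" "n \<in> W_orth W S" "n' \<in> W_orth W S" for m n m' n'
  proof -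
    have "cinner m (W n') = 0"
      using that by (simp add: W_orth_def cinner_eq_zero_commute[of m])
    moreover have "cinner n (W m') = 0"
      using that by (simp add: W_orth_def flip: selfadjoint_op_graph_cinner[OF sa])
    ultimately show ?thesis
      by (simp add: bounded_clinear_add[OF bdd] cinner_add_left cinner_add_right)
  qed
  then show ?thesis
    unfolding W_proj_def op_graph_rel_prod_proj_rel
    by (fastforce simp: rel_adjoint_def rel_prod_def op_graph_def proj_rel_def)
qed

lemma rel_adjoint_single_valued:
  assumes dom: "Domain T = UNIV" and "(x, y) \<in> rel_adjoint T" "(x, z) \<in> rel_adjoint T"
  shows "y = z"
proof -
  \<comment> \<open>The difference of the two images serves as its own test vector: it lies in the
    domain and must be orthogonal to itself.\<close>
  obtain g where "(y - z, g) \<in> T"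
    using dom by blast
  then have "cinner (y - z) y = cinner (y - z) z"
    using assms(2,3) by (fastforce simp: rel_adjoint_def)
  then have "cinner (y - z) (y - z) = 0"
    by (simp add: cinner_diff_right)
  then show ?thesis by simp
qed

section \<open>Equivalent forms of complementability\<close>

lemma complementable_adjoint_eq:
  assumes bdd: "bounded_clinear W" and sa: "selfadjoint_relation (op_graph W)"
    and comp: "complementable W S"
  shows "op_graph W \<odot> W_proj W S = rel_adjoint (W_proj W S) \<odot> op_graph W"
proof
  show "rel_adjoint (W_proj W S) \<odot> op_graph W \<subseteq> op_graph W \<odot> W_proj W S"
  proof
    fix p assume p: "p \<in> rel_adjoint (W_proj W S) \<odot> op_graph W"
    then obtain x y where xy: "p = (x, y)" "(W x, y) \<in> rel_adjoint (W_proj W S)"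
      by (auto simp: rel_prod_def op_graph_def)
    \<comment> \<open>An everywhere defined projection supplies a candidate \<open>W m\<close> for
      the image of \<open>x\<close>; single-valuedness of the adjoint then forces \<open>y\<close>
      to be that candidate.\<close>
    obtain m where "(x, m) \<in> W_proj W S"
      using comp unfolding complementable_def by blast
    then have WP: "(x, W m) \<in> op_graph W \<odot> W_proj W S"
      by (auto simp: rel_prod_def op_graph_def)
    then have "(W x, W m) \<in> rel_adjoint (W_proj W S)"
      using op_graph_W_proj_subset[OF bdd sa, of S] by (auto simp: rel_prod_def op_graph_def)
    then have "y = W m"
      using rel_adjoint_single_valued comp xy(2) unfolding complementable_def by blast
    then show "p \<in> op_graph W \<odot> W_proj W S"
      using WP xy(1) by simp
  qed
qed (rule op_graph_W_proj_subset[OF bdd sa])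

lemma complementable_range_subset:
  assumes bdd: "bounded_clinear W" and sa: "selfadjoint_relation (op_graph W)"
    and comp: "complementable W S"
  shows "range W \<subseteq> Domain (rel_adjoint (W_proj W S))"
proof clarify
  fix x
  obtain m where "(x, m) \<in> W_proj W S"
    using comp unfolding complementable_def by blast
  then have "(x, W m) \<in> op_graph W \<odot> W_proj W S"
    by (auto simp: rel_prod_def op_graph_def)
  then show "W x \<in> Domain (rel_adjoint (W_proj W S))"
    using op_graph_W_proj_subset[OF bdd sa, of S] by (auto simp: rel_prod_def op_graph_def)
qed

lemma complementableI_adjoint:
  assumes eq: "op_graph W \<odot> W_proj W S = rel_adjoint (W_proj W S) \<odot> op_graph W"
    and ran: "range W \<subseteq> Domain (rel_adjoint (W_proj W S))"
  shows "complementable W S"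
proof -
  have "x \<in> Domain (W_proj W S)" for x
  proof -
    \<comment> \<open>The range condition makes the right-hand side of \<open>eq\<close> everywhere
      defined; the equality transfers this to \<open>WP\<close>, whose domain lies in that of
      \<open>P\<close>.\<close>
    obtain y where "(W x, y) \<in> rel_adjoint (W_proj W S)"
      using ran by blast
    then have "(x, y) \<in> op_graph W \<odot> W_proj W S"
      unfolding eq by (auto simp: rel_prod_def op_graph_def)
    then show ?thesis
      by (auto simp: rel_prod_def)
  qed
  then show ?thesis
    unfolding complementable_def by blast
qed

lemma complementableI_projection:
  assumes bdd: "bounded_clinear W" and sa: "selfadjoint_relation (op_graph W)"
    and Q: "multivalued_projection Q" "W_selfadjoint W Q" "Domain Q = UNIV"
  shows "complementable W (Range Q)"
proof -
  have "x \<in> Domain (W_proj W (Range Q))" for x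
  proof -
    obtain m where xm: "(x, m) \<in> Q"
      using Q(3) by blast
    \<comment> \<open>Since \<open>W 0 = 0\<close>, kernel elements of \<open>Q\<close> lie in the
      kernel of \<open>WQ\<close>, where selfadjointness can be applied.\<close>
    have "(x - m, 0) \<in> op_graph W \<odot> Q"
      using multivalued_projection_diff_in_kernel[OF Q(1) xm] bounded_clinear_zero[OF bdd]
      by (auto simp: rel_prod_def op_graph_def)
    then have "(x - m, 0) \<in> rel_adjoint (op_graph W \<odot> Q)"
      using Q(2) by (simp add: W_selfadjoint_def selfadjoint_relation_def)
    then have "(W (x - m), 0) \<in> rel_adjoint Q"
      unfolding rel_adjoint_op_graph_rel_prod[OF sa] by (auto simp: rel_prod_def op_graph_def)
    \<comment> \<open>Pairing with any \<open>(f, s) \<in> Q\<close> gives \<open>cinner f 0\<close>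
      on the other side.\<close>
    then have "cinner s (W (x - m)) = 0" if "s \<in> Range Q" for s
      using that by (fastforce simp: rel_adjoint_def)
    then have "x - m \<in> W_orth W (Range Q)"
      by (simp add: W_orth_def cinner_eq_zero_commute[of "W (x - m)"])
    moreover have "m \<in> Range Q"
      using xm by blast
    ultimately have "(m + (x - m), m) \<in> W_proj W (Range Q)"
      unfolding W_proj_def proj_rel_def by blast
    then show ?thesis by auto
  qed
  then show ?thesis
    unfolding complementable_def by blast
qed

theorem proposition4p4:
  fixes W :: "'a::complex_hilbert_space \<Rightarrow> 'a" and S :: "'a set"
  assumes separable: "separable_space (euclidean :: 'a topology)"
    and W_bounded: "bounded_clinear W"
    and W_sa: "selfadjoint_relation (op_graph W)"
    and S_subspace: "csubspace S"
  shows "(complementable W S \<longleftrightarrow>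
      op_graph W \<odot> W_proj W S = rel_adjoint (W_proj W S) \<odot> op_graph W \<and>
      range W \<subseteq> Domain (rel_adjoint (W_proj W S)))
    \<and> (complementable W S \<longleftrightarrow>
      (\<exists>Q. multivalued_projection Q \<and> W_selfadjoint W Q \<and> Range Q = S \<and> Domain Q = UNIV))"
proof (intro conjI)
  show "complementable W S \<longleftrightarrow>
      op_graph W \<odot> W_proj W S = rel_adjoint (W_proj W S) \<odot> op_graph W \<and>
      range W \<subseteq> Domain (rel_adjoint (W_proj W S))"
    using complementable_adjoint_eq[OF W_bounded W_sa]
      complementable_range_subset[OF W_bounded W_sa] complementableI_adjoint
    by blast
  show "complementable W S \<longleftrightarrow>
      (\<exists>Q. multivalued_projection Q \<and> W_selfadjoint W Q \<and> Range Q = S \<and> Domain Q = UNIV)"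
  proof
    assume comp: "complementable W S"
    have N: "csubspace (W_orth W S)"
      by (rule csubspace_W_orth[OF W_bounded])
    have "multivalued_projection (W_proj W S)"
      unfolding W_proj_def by (rule multivalued_projection_proj_rel[OF S_subspace N])
    \<comment> \<open>Once the adjoint of \<open>WP\<close> is rewritten as the product of the
      adjoint of \<open>P\<close> with \<open>W\<close>, selfadjointness is exactly the equation in
      (ii).\<close>
    moreover have "W_selfadjoint W (W_proj W S)"
      unfolding W_selfadjoint_def selfadjoint_relation_def
        rel_adjoint_op_graph_rel_prod[OF W_sa]
      by (rule complementable_adjoint_eq[OF W_bounded W_sa comp])
    moreover have "Range (W_proj W S) = S"
      unfolding W_proj_def by (rule Range_proj_rel[OF complex_vector.subspace_0[OF N]])
    ultimately show "\<exists>Q. multivalued_projection Q \<and> W_selfadjoint W Q \<and> Range Q = S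
        \<and> Domain Q = UNIV"
      using comp unfolding complementable_def by blast
  next
    assume "\<exists>Q. multivalued_projection Q \<and> W_selfadjoint W Q \<and> Range Q = S \<and> Domain Q = UNIV"
    then show "complementable W S"
      using complementableI_projection[OF W_bounded W_sa] by blast
  qed
qed

end
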